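(* For every nonconstant $\eta\in\{+,-\}^n$, $$\sum_{\pi\in S_n}t^{\operatorname{crec}_\eta(\pi)} = n!\,\Omega(C_\eta;t)$$ as polynomials in $t$.
   Context: Subscripts of $\eta$ and of vertices are read modulo $n$. "Nonconstant" means both signs occur in $\eta=(\eta_1,\ldots,\eta_n)$. The poset $C_\eta$ on $\{x_1,\ldots,x_n\}$ is the transitive closure of the relations $x_i\succ x_{i+1}$ if $\eta_i=+$, and $x_i\prec x_{i+1}$ if $\eta_i=-$, for $i$ modulo $n$ (this is acyclic since $\eta$ is nonconstant). Order polynomial: for a finite poset $P$, $\Omega(P;t)$ is the polynomial with $\Omega(P;m)=\#\{f:P\to[m]\text{ (weakly) order-preserving}\}$ for all positive integers $m$, where $[m]=\{1,\ldots,m\}$. Cyclic records: let $I_+(\eta)=\{i\in[n]:\eta_i=+\}$. For $\pi=\pi_1\cdots\pi_n\in S_n$ let $r$ be the unique index in $I_+(\eta)$ with $\pi_r=\max\{\pi_i:i\in I_+(\eta)\}$. Position $r$ is declared a record and the initial threshold is $h=\pi_r$. Inspect the remaining positions in the cyclic order $r-1,r-2,\ldots,r+1$ (modulo $n$). When position $i$ is inspected, it is a record if ($\eta_i=+$ and $\pi_i>h$) or ($\eta_i=-$ and $\pi_i<h$); whenever a record occurs, $h$ is reset to $\pi_i$. The total number of records (including $r$) is $\operatorname{crec}_\eta(\pi)$. *)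

theory Defs
  imports Complex_Main "HOL-Library.FuncSet" "HOL-Combinatorics.Permutations"
    "HOL-Computational_Algebra.Polynomial"
begin

section \<open>Finite posets and order polynomials\<close>

text \<open>A poset is a carrier \<open>A\<close> with a reflexive relation \<open>r\<close> such that \<^term>\<open>partial_order_on A r\<close>;
  \<open>(x, y) \<in> r\<close> means \<open>x \<preceq> y\<close>. Extensional functions are used so that each map from \<open>A\<close> is
  counted once.\<close>

definition order_preserving_maps :: "'a set \<Rightarrow> 'a rel \<Rightarrow> nat \<Rightarrow> ('a \<Rightarrow> nat) set" where
  "order_preserving_maps A r m =
     {f \<in> A \<rightarrow>\<^sub>E {1..m}. monotone_on A (\<lambda>x y. (x, y) \<in> r) (\<le>) f}"

text \<open>Order polynomials have rational, in general non-integral, coefficients.\<close>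

definition order_polynomial :: "'a set \<Rightarrow> 'a rel \<Rightarrow> rat poly" where
  "order_polynomial A r =
     (THE p. \<forall>m::nat. m \<ge> 1 \<longrightarrow> poly p (of_nat m) = of_nat (card (order_preserving_maps A r m)))"


section \<open>Cyclic sign vectors and their posets\<close>

text \<open>A sign vector of length \<open>n\<close> is a function on indices of which only the values on \<open>{1..n}\<close>
  matter. Representatives of the indices modulo \<open>n\<close> are taken in \<open>{1..n}\<close>.\<close>

datatype sign = Pos | Neg

definition nonconstant :: "nat \<Rightarrow> (nat \<Rightarrow> sign) \<Rightarrow> bool" where
  "nonconstant n \<eta> \<longleftrightarrow> (\<exists>i\<in>{1..n}. \<eta> i = Pos) \<and> (\<exists>i\<in>{1..n}. \<eta> i = Neg)"

definition cyc_succ :: "nat \<Rightarrow> nat \<Rightarrow> nat" where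
  "cyc_succ n i = (if i = n then 1 else i + 1)"

definition cyc_pred :: "nat \<Rightarrow> nat \<Rightarrow> nat" where
  "cyc_pred n i = (if i = 1 then n else i - 1)"

text \<open>The vertex \<open>x\<^sub>i\<close> is represented by its index \<open>i\<close>.\<close>

definition cyc_gen :: "nat \<Rightarrow> (nat \<Rightarrow> sign) \<Rightarrow> nat rel" where
  "cyc_gen n \<eta> = {(cyc_succ n i, i) | i. i \<in> {1..n} \<and> \<eta> i = Pos} \<union>
                 {(i, cyc_succ n i) | i. i \<in> {1..n} \<and> \<eta> i = Neg}"

definition cyc_order :: "nat \<Rightarrow> (nat \<Rightarrow> sign) \<Rightarrow> nat rel" where
  "cyc_order n \<eta> = Id_on {1..n} \<union> (cyc_gen n \<eta>)\<^sup>+"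

lemma partial_order_on_cyc_order:
  assumes "nonconstant n \<eta>"
  shows "partial_order_on {1..n} (cyc_order n \<eta>)"
proof -
  define a where "a = int (card {i \<in> {1..n}. \<eta> i = Neg})"
  define b where "b = int (card {i \<in> {1..n}. \<eta> i = Pos})"
  define w where "w = (\<lambda>i. if \<eta> i = Pos then - a else b)"
  define g where "g = (\<lambda>i. \<Sum>l\<in>{1..<i}. w l)"
  have a: "a > 0" and b: "b > 0"
    using assms by (auto simp: a_def b_def nonconstant_def card_gt_0_iff)
  have "(\<Sum>l\<in>{1..n}. w l) = (\<Sum>l\<in>{l\<in>{1..n}. \<eta> l = Pos}. - a) + (\<Sum>l\<in>{l\<in>{1..n}. \<eta> l = Neg}. b)"
  proof -
    have "{1..n} \<inter> {l. \<eta> l = Pos} = {l\<in>{1..n}. \<eta> l = Pos}"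
      and "{1..n} \<inter> - {l. \<eta> l = Pos} = {l\<in>{1..n}. \<eta> l = Neg}"
      by (auto, metis sign.exhaust)
    then show ?thesis
      unfolding w_def by (subst sum.If_cases) simp_all
  qed
  also have "\<dots> = 0" by (simp add: a_def b_def)
  finally have tot: "(\<Sum>l\<in>{1..n}. w l) = 0" .
  have step: "g (cyc_succ n i) = g i + w i" if "i \<in> {1..n}" for i
  proof (cases "i = n")
    case True
    have "{1..n} = insert n {1..<n}" using that True by auto
    then show ?thesis using True tot by (simp add: g_def cyc_succ_def)
  next
    case False
    have "{1..<Suc i} = insert i {1..<i}" using that by auto
    then show ?thesis using False by (simp add: g_def cyc_succ_def)
  qed
  have gen: "g x < g y" if "(x, y) \<in> cyc_gen n \<eta>" for x y
    using that a b by (auto simp: cyc_gen_def step w_def)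
  have less: "g x < g y" if "(x, y) \<in> (cyc_gen n \<eta>)\<^sup>+" for x y
    using that by (induction rule: trancl_induct) (auto dest: gen)
  have sub: "cyc_gen n \<eta> \<subseteq> {1..n} \<times> {1..n}"
    by (auto simp: cyc_gen_def cyc_succ_def)
  have sub': "(cyc_gen n \<eta>)\<^sup>+ \<subseteq> {1..n} \<times> {1..n}"
    using trancl_subset_Sigma[OF sub] .
  show ?thesis
    unfolding partial_order_on_def preorder_on_def
  proof (intro conjI)
    show "cyc_order n \<eta> \<subseteq> {1..n} \<times> {1..n}" using sub' by (auto simp: cyc_order_def)
    show "refl_on {1..n} (cyc_order n \<eta>)" by (auto simp: cyc_order_def refl_on_def)
    show "trans (cyc_order n \<eta>)"
      by (auto simp: cyc_order_def trans_def intro: trancl_trans)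
    show "antisym (cyc_order n \<eta>)"
      unfolding antisym_def cyc_order_def using less less_asym by blast
  qed
qed


section \<open>Cyclic records\<close>

definition pos_indices :: "nat \<Rightarrow> (nat \<Rightarrow> sign) \<Rightarrow> nat set" where
  "pos_indices n \<eta> = {i \<in> {1..n}. \<eta> i = Pos}"

definition first_record :: "nat \<Rightarrow> (nat \<Rightarrow> sign) \<Rightarrow> (nat \<Rightarrow> nat) \<Rightarrow> nat" where
  "first_record n \<eta> \<pi> =
     (THE r. r \<in> pos_indices n \<eta> \<and> \<pi> r = Max (\<pi> ` pos_indices n \<eta>))"

text \<open>The number of records met when the listed positions are inspected from left to right, starting
  with threshold \<open>h\<close>.\<close>

fun count_records :: "(nat \<Rightarrow> sign) \<Rightarrow> (nat \<Rightarrow> nat) \<Rightarrow> nat \<Rightarrow> nat list \<Rightarrow> nat" where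
  "count_records \<eta> \<pi> h [] = 0"
| "count_records \<eta> \<pi> h (i # is) =
     (if (\<eta> i = Pos \<and> \<pi> i > h) \<or> (\<eta> i = Neg \<and> \<pi> i < h)
      then Suc (count_records \<eta> \<pi> (\<pi> i) is)
      else count_records \<eta> \<pi> h is)"

definition crec :: "nat \<Rightarrow> (nat \<Rightarrow> sign) \<Rightarrow> (nat \<Rightarrow> nat) \<Rightarrow> nat" where
  "crec n \<eta> \<pi> =
     (let r = first_record n \<eta> \<pi>
      in Suc (count_records \<eta> \<pi> (\<pi> r) (map (\<lambda>k. (cyc_pred n ^^ k) r) [1..<n])))"

end

theory Submission
  imports Defs "HOL-Combinatorics.Multiset_Permutations"
begin

text \<open>
  A polynomial is determined by its values at the positive integers, so it suffices to show that for
  every \<open>m \<ge> 1\<close> the sum of \<open>m ^ crec \<pi>\<close> over all permutations is \<open>n!\<close> times the number of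
  order-preserving maps from the cyclic poset to \<open>{1..m}\<close>. Both sides are functions of a cyclic word
  of signs, and they obey the same recursion.

  \<^item> Maps. Give one letter of the word both signs and add. The two relations \<open>x \<le> y\<close> and
    \<open>x \<ge> y\<close> together are ``no relation'' plus \<open>x = y\<close>. So the two counts add up to the count for
    the word with the letter deleted (\<open>x\<close> and \<open>y\<close> are identified) plus the count for the cycle cut
    open at that letter (\<open>closed_walks\<close>, lemma \<open>closed_walks_flip\<close>).

  \<^item> Records. Let the inspection run round the cycle periodically. Whatever the threshold is when
    a position is inspected, exactly one of the two signs makes it a record. With the other sign the
    position might as well be deleted. With the sign that makes it a record, the threshold becomes
    the value at this position, and the remaining records are those of a linear inspection of the
    other positions that starts with this threshold (lemma \<open>cyclic_records_flip\<close>).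

  A word with a minus sign can be rotated so that this sign comes first; flipping it gives a word with
  fewer minus signs. Repeating this ends at words without minus signs, for which both sides are
  immediate (lemma \<open>cyclic_sum_eq_closed_walks\<close>). The induction needs the linear analogue of the
  theorem for the cut words, which is lemma \<open>sum_records_from_first\<close>.

  For the linear analogue, let \<open>f j l\<close> be the sum of \<open>m ^ records\<close> over all orders of the values still to
  be inspected, where \<open>j\<close> of them lie below the threshold and \<open>l\<close> above it. One more letter acts on
  such functions by a linear operator (\<open>inspection\<close> below), and it acts on vectors indexed by
  \<open>{1..m}\<close> by the matrix of the relation \<open>\<le>\<close> or \<open>\<ge>\<close>. The bridge between the two actions is the operator
  that inserts an ignored element. It commutes with every letter, and for functions on the pairs with
  \<open>j + l = m - 1\<close>, which are exactly vectors of length \<open>m\<close>, the operator of a letter is the matrix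
  followed by an insertion (lemmas \<open>inspection_insertion\<close> and \<open>inspection_walk_vector\<close>). In the continuous
  picture, where the values are independent and uniform on \<open>[0,1]\<close>, this says that polynomials of
  degree less than \<open>m\<close> are invariant and that the letters are triangular matrices of ones in the
  Bernstein basis.
\<close>

section \<open>Records in cyclic lists\<close>

text \<open>
  The threshold after an item (a sign with a value) has been inspected. An item is a record exactly
  if it changes the threshold, which makes every statement about records one about clamping maps.
\<close>

fun update :: "sign \<times> nat \<Rightarrow> nat \<Rightarrow> nat" where
  "update (Pos, v) h = max h v"
| "update (Neg, v) h = min h v"

lemma item_cases:
  fixes x :: "sign \<times> nat"
  obtains (Pos) v where "x = (Pos, v)" | (Neg) v where "x = (Neg, v)"
  by (metis sign.exhaust surj_pair)

fun records :: "(sign \<times> nat) list \<Rightarrow> nat \<Rightarrow> nat" where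
  "records [] h = 0"
| "records (x # xs) h = (if update x h = h then 0 else 1) + records xs (update x h)"

abbreviation final :: "(sign \<times> nat) list \<Rightarrow> nat \<Rightarrow> nat" where
  "final xs \<equiv> fold update xs"

text \<open>
  The number of records in one period of the stationary inspection of a cyclic list. Starting with
  threshold \<open>0\<close>, the threshold is stationary after one round. If all values with sign \<open>Neg\<close> exceed all
  values with sign \<open>Pos\<close>, the stationary inspection has no record at all, but the initial position
  still counts as one, hence the maximum with \<open>1\<close>.
\<close>

definition cyclic_records :: "(sign \<times> nat) list \<Rightarrow> nat" where
  "cyclic_records xs = max 1 (records xs (final xs 0))"

lemma records_append: "records (xs @ ys) h = records xs h + records ys (final xs h)"
  by (induction xs arbitrary: h) auto

text \<open>
  A composition of maps \<open>max v\<close> and \<open>min v\<close> clamps its argument to an interval, possibly one that is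
  unbounded above.
\<close>

lemma final_idem: "final xs (final xs h) = final xs h"
proof -
  have "\<exists>a. (\<forall>h. final xs h = max a h) \<or> (\<exists>b\<ge>a. \<forall>h. final xs h = max a (min b h))"
  proof (induction xs rule: rev_induct)
    case Nil
    have "\<forall>h. final [] h = max 0 h" by simp
    then show ?case by blast
  next
    case (snoc x xs)
    show ?case
    proof (cases x rule: item_cases)
      case (Pos v)
      from snoc obtain a where
        "(\<forall>h. final xs h = max a h) \<or> (\<exists>b\<ge>a. \<forall>h. final xs h = max a (min b h))" by blast
      then have "(\<forall>h. final (xs @ [x]) h = max (max a v) h) \<or>
          (\<exists>b\<ge>max a v. \<forall>h. final (xs @ [x]) h = max (max a v) (min b h))"
      proof (elim disjE exE conjE)
        fix b assume "a \<le> b" and *: "\<forall>h. final xs h = max a (min b h)"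
        then have "\<forall>h. final (xs @ [x]) h = max (max a v) (min (max b v) h)"
          by (auto simp: Pos max_def min_def)
        moreover have "max a v \<le> max b v" using \<open>a \<le> b\<close> by simp
        ultimately show ?thesis by blast
      qed (use Pos in \<open>simp add: max.commute max.left_commute\<close>)
      then show ?thesis by blast
    next
      case (Neg v)
      from snoc obtain a where
        "(\<forall>h. final xs h = max a h) \<or> (\<exists>b\<ge>a. \<forall>h. final xs h = max a (min b h))" by blast
      then have "\<exists>b\<ge>min a v. \<forall>h. final (xs @ [x]) h = max (min a v) (min b h)"
      proof (elim disjE exE conjE)
        assume "\<forall>h. final xs h = max a h"
        then have "\<forall>h. final (xs @ [x]) h = max (min a v) (min v h)"
          by (auto simp: Neg max_def min_def)
        then show ?thesis by (meson min.cobounded2)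
      next
        fix b assume "a \<le> b" and *: "\<forall>h. final xs h = max a (min b h)"
        then have "\<forall>h. final (xs @ [x]) h = max (min a v) (min (min b v) h)"
          by (auto simp: Neg max_def min_def)
        moreover have "min a v \<le> min b v" using \<open>a \<le> b\<close> by simp
        ultimately show ?thesis by blast
      qed
      then show ?thesis by blast
    qed
  qed
  then show ?thesis by auto
qed

text \<open>
  Clamping never widens the gap between two thresholds, and preserves it only if it moves neither
  of them.
\<close>

lemma update_gap:
  assumes "h \<le> h'"
  shows "update x h \<le> update x h'" "update x h' - update x h \<le> h' - h"
    and "h < h' \<Longrightarrow> update x h' - update x h = h' - h \<Longrightarrow> update x h = h \<and> update x h' = h'"
  using assms by (cases x rule: item_cases; auto simp: max_def min_def split: if_splits)+

lemma final_mono: "h \<le> h' \<Longrightarrow> final xs h \<le> final xs h'"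
  by (induction xs arbitrary: h h') (auto intro: update_gap)

lemma final_gap: "h \<le> h' \<Longrightarrow> final xs h' - final xs h \<le> h' - h"
proof (induction xs arbitrary: h h')
  case (Cons x xs)
  show ?case using Cons.IH[OF update_gap(1)[OF Cons.prems, of x]] update_gap(2)[OF Cons.prems, of x]
    by simp
qed simp

lemma records_eq_0_if_gap_preserved:
  "h < h' \<Longrightarrow> final xs h' - final xs h = h' - h \<Longrightarrow> records xs h = 0 \<and> records xs h' = 0"
proof (induction xs arbitrary: h h')
  case (Cons x xs)
  have le: "h \<le> h'" using Cons.prems(1) by simp
  have "update x h' - update x h = h' - h"
    using final_gap[OF update_gap(1)[OF le, of x], of xs] update_gap(2)[OF le, of x] Cons.prems(2)
    by simp
  then have "update x h = h \<and> update x h' = h'" by (rule update_gap(3)[OF le Cons.prems(1)])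
  then show ?case using Cons by simp
qed simp

text \<open>
  Any stationary threshold gives the same count. For if there are two of them, one round preserves
  the gap between them, so there are no records from either.
\<close>

lemma cyclic_records_unique:
  assumes "final xs h = h"
  shows "cyclic_records xs = max 1 (records xs h)"
proof -
  define g where "g = final xs 0"
  have g: "final xs g = g" by (simp add: final_idem g_def)
  have "g = h \<or> records xs g = records xs h"
    using records_eq_0_if_gap_preserved[of g h xs] records_eq_0_if_gap_preserved[of h g xs]
      assms g by (metis linorder_neqE_nat)
  then show ?thesis by (auto simp: cyclic_records_def g_def)
qed

lemma cyclic_records_cases:
  obtains h where "final xs h = h" "h \<in> insert 0 (snd ` set xs)" "cyclic_records xs = max 1 (records xs h)"
proof -
  have "final xs k \<in> insert k (snd ` set xs)" for k
  proof (induction xs arbitrary: k)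
    case (Cons x xs)
    then show ?case using Cons[of "update x k"]
      by (cases x rule: item_cases) (auto simp: max_def min_def split: if_splits)
  qed simp
  then show ?thesis using that[OF final_idem[of xs 0]] by (simp add: cyclic_records_def)
qed

lemma cyclic_records_rotate: "cyclic_records (xs @ ys) = cyclic_records (ys @ xs)"
proof -
  obtain h where h: "final (xs @ ys) h = h"  "cyclic_records (xs @ ys) = max 1 (records (xs @ ys) h)"
    by (rule cyclic_records_cases)
  have "final (ys @ xs) (final xs h) = final xs h" using h(1) by simp
  then have "cyclic_records (ys @ xs) = max 1 (records (ys @ xs) (final xs h))"
    by (rule cyclic_records_unique)
  then show ?thesis using h by (simp add: records_append)
qed

text \<open>
  After a round the threshold has been clamped back to \<open>v\<close> by the first item, which is therefore a
  record unless nothing happened in the round. In the latter case the count is \<open>1\<close> by convention.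
\<close>

lemma cyclic_records_Cons:
  assumes "update x (final xs v) = v" "final xs v = v \<Longrightarrow> records xs v = 0"
  shows "cyclic_records (x # xs) = Suc (records xs v)"
proof -
  have "final (x # xs) (final xs v) = final xs v" by (simp add: assms(1))
  then have "cyclic_records (x # xs) = max 1 (records (x # xs) (final xs v))"
    by (rule cyclic_records_unique)
  also have "records (x # xs) (final xs v) = (if v = final xs v then 0 else 1) + records xs v"
    by (simp only: records.simps assms(1))
  finally show ?thesis using assms(2) by (cases "final xs v = v") simp_all
qed

text \<open>
  Let \<open>h\<close> be a stationary threshold for \<open>xs\<close>, and say \<open>h < v\<close>. The item \<open>(Neg, v)\<close> ignores \<open>h\<close>. The item
  \<open>(Pos, v)\<close> raises the threshold to \<open>v\<close>, and a round from \<open>v\<close> ends at most at \<open>v\<close> because it cannot widen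
  the gap to \<open>h\<close>. So the item is met with a threshold of at most \<open>v\<close> again.
\<close>

lemma cyclic_records_flip:
  assumes "v \<notin> snd ` set xs" "v > 0"
  shows "(cyclic_records ((Pos, v) # xs) = Suc (records xs v) \<and> cyclic_records ((Neg, v) # xs) = cyclic_records xs) \<or>
         (cyclic_records ((Pos, v) # xs) = cyclic_records xs \<and> cyclic_records ((Neg, v) # xs) = Suc (records xs v))"
proof -
  obtain h where h: "final xs h = h" "h \<in> insert 0 (snd ` set xs)" "cyclic_records xs = max 1 (records xs h)"
    by (rule cyclic_records_cases)
  have ignore: "cyclic_records (x # xs) = cyclic_records xs" if "update x h = h" for x
    using cyclic_records_unique[of "x # xs" h] that h by simp
  have "h \<noteq> v" using assms h(2) by auto
  then consider "h < v" | "v < h" by linarith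
  then show ?thesis
  proof cases
    case 1
    then have "final xs v \<le> v" "final xs v = v \<Longrightarrow> records xs v = 0"
      using final_mono[of h v xs] final_gap[of h v xs] records_eq_0_if_gap_preserved[of h v xs] h(1) by auto
    then have "cyclic_records ((Pos, v) # xs) = Suc (records xs v)"
      by (intro cyclic_records_Cons) simp_all
    moreover have "cyclic_records ((Neg, v) # xs) = cyclic_records xs"
      using 1 by (intro ignore) simp
    ultimately show ?thesis by blast
  next
    case 2
    then have "final xs v \<ge> v" "final xs v = v \<Longrightarrow> records xs v = 0"
      using final_mono[of v h xs] final_gap[of v h xs] records_eq_0_if_gap_preserved[of v h xs] h(1) by auto
    then have "cyclic_records ((Neg, v) # xs) = Suc (records xs v)"
      by (intro cyclic_records_Cons) simp_all
    moreover have "cyclic_records ((Pos, v) # xs) = cyclic_records xs"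
      using 2 by (intro ignore) simp
    ultimately show ?thesis by blast
  qed
qed

lemma cyclic_records_all_Pos:
  assumes "\<And>x. x \<in> set xs \<Longrightarrow> fst x = Pos"
  shows "cyclic_records xs = 1"
proof -
  define h where "h = Max (insert 0 (snd ` set xs))"
  have "final ys h = h \<and> records ys h = 0" if "set ys \<subseteq> set xs" for ys
    using that
  proof (induction ys)
    case (Cons y ys)
    moreover have "snd y \<le> h" using Cons.prems unfolding h_def by (intro Max_ge) auto
    moreover have "fst y = Pos" using assms Cons.prems by auto
    ultimately have "update y h = h" by (cases y) simp
    then show ?case using Cons by simp
  qed simp
  then show ?thesis using cyclic_records_unique[of xs h] by simp
qed

section \<open>Walks along a word of signs\<close>

fun leq :: "sign \<Rightarrow> nat \<Rightarrow> nat \<Rightarrow> bool" where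
  "leq Pos a b = (a \<le> b)"
| "leq Neg a b = (b \<le> a)"

text \<open>
  Walks from \<open>a\<close> to \<open>b\<close> in \<open>{1..m}\<close> whose steps weakly increase at the letters \<open>Pos\<close> and weakly decrease
  at the letters \<open>Neg\<close>. These are the entries of a product of triangular matrices of ones.
\<close>

fun walks :: "nat \<Rightarrow> sign list \<Rightarrow> nat \<Rightarrow> nat \<Rightarrow> nat" where
  "walks m [] a b = (if a = b then 1 else 0)"
| "walks m (s # w) a b = (\<Sum>c = 1..m. of_bool (leq s a c) * walks m w c b)"

definition walks_from :: "nat \<Rightarrow> sign list \<Rightarrow> nat \<Rightarrow> nat" where
  "walks_from m w a = (\<Sum>b = 1..m. walks m w a b)"

definition all_walks :: "nat \<Rightarrow> sign list \<Rightarrow> nat" where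
  "all_walks m w = (\<Sum>a = 1..m. walks_from m w a)"

definition closed_walks :: "nat \<Rightarrow> sign list \<Rightarrow> nat" where
  "closed_walks m w = (\<Sum>a = 1..m. walks m w a a)"

lemma walks_from_Nil: "a \<in> {1..m} \<Longrightarrow> walks_from m [] a = 1"
  by (simp add: walks_from_def)

lemma walks_from_Cons: "walks_from m (s # w) a = (\<Sum>c = 1..m. of_bool (leq s a c) * walks_from m w c)"
  
  unfolding walks_from_def walks.simps sum_distrib_left by (rule sum.swap)

lemma walks_append:
  assumes "a \<in> {1..m}"
  shows "walks m (u @ v) a b = (\<Sum>c = 1..m. walks m u a c * walks m v c b)"
  using assms
proof (induction u arbitrary: a)
  case Nil
  have "(\<Sum>c = 1..m. walks m [] a c * walks m v c b) = (\<Sum>c = 1..m. if a = c then walks m v c b else 0)"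
    by (intro sum.cong) auto
  then show ?case using Nil by simp
next
  case (Cons s u)
  have "walks m ((s # u) @ v) a b =
      (\<Sum>c = 1..m. \<Sum>d = 1..m. of_bool (leq s a c) * walks m u c d * walks m v d b)"
    by (simp add: Cons.IH sum_distrib_left mult.assoc del: sum_of_bool_mult_eq)
  also have "\<dots> = (\<Sum>d = 1..m. \<Sum>c = 1..m. of_bool (leq s a c) * walks m u c d * walks m v d b)"
    by (rule sum.swap)
  finally show ?case by (simp add: sum_distrib_right del: sum_of_bool_mult_eq)
qed

lemma closed_walks_rotate: "closed_walks m (u @ v) = closed_walks m (v @ u)"
proof -
  have "closed_walks m (u @ v) = (\<Sum>a = 1..m. \<Sum>c = 1..m. walks m u a c * walks m v c a)"
    unfolding closed_walks_def by (intro sum.cong refl walks_append)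
  also have "\<dots> = (\<Sum>c = 1..m. \<Sum>a = 1..m. walks m v c a * walks m u a c)"
    by (subst sum.swap) (simp add: mult.commute)
  also have "\<dots> = closed_walks m (v @ u)"
    unfolding closed_walks_def by (intro sum.cong refl walks_append[symmetric])
  finally show ?thesis .
qed

text \<open>
  The two triangular matrices of ones add up to the identity matrix plus the matrix of ones.
\<close>

lemma closed_walks_flip:
  "closed_walks m (Pos # w) + closed_walks m (Neg # w) = closed_walks m w + all_walks m w"
proof -
  have "walks m (Pos # w) a a + walks m (Neg # w) a a = walks m w a a + (\<Sum>c = 1..m. walks m w c a)"
    if "a \<in> {1..m}" for a
  proof -
    have "walks m (Pos # w) a a + walks m (Neg # w) a a =
        (\<Sum>c = 1..m. (if c = a then walks m w a a else 0) + walks m w c a)"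
      unfolding walks.simps sum.distrib[symmetric] by (intro sum.cong) auto
    then show ?thesis using that by (simp add: sum.distrib)
  qed
  then have "closed_walks m (Pos # w) + closed_walks m (Neg # w) =
      (\<Sum>a = 1..m. walks m w a a + (\<Sum>c = 1..m. walks m w c a))"
    unfolding closed_walks_def by (simp add: sum.distrib[symmetric])
  also have "\<dots> = closed_walks m w + (\<Sum>a = 1..m. \<Sum>c = 1..m. walks m w c a)"
    by (simp add: closed_walks_def sum.distrib)
  also have "(\<Sum>a = 1..m. \<Sum>c = 1..m. walks m w c a) = all_walks m w"
    unfolding all_walks_def walks_from_def by (rule sum.swap)
  finally show ?thesis .
qed

lemma closed_walks_all_Pos:
  assumes "\<And>s. s \<in> set w \<Longrightarrow> s = Pos"
  shows "closed_walks m w = m"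
proof -
  have "b < a \<Longrightarrow> walks m w a b = 0" and "a \<in> {1..m} \<Longrightarrow> walks m w a a = 1" for a b
    using assms
  proof (induction w arbitrary: a b)
    case (Cons s w)
    { case 1
      then have s: "s = Pos" and w: "\<And>s. s \<in> set w \<Longrightarrow> s = Pos" by auto
      show ?case using Cons.IH(1)[OF _ w] 1(1) by (auto simp: s)
    next
      case 2
      then have s: "s = Pos" and w: "\<And>s. s \<in> set w \<Longrightarrow> s = Pos" by auto
      have "walks m (s # w) a a = (\<Sum>c = 1..m. if c = a then 1 else 0)"
        unfolding s walks.simps using Cons.IH[OF _ w] by (intro sum.cong) (auto simp: le_less)
      then show ?case using 2 by simp }
  qed auto
  then show ?thesis by (simp add: closed_walks_def)
qed

section \<open>Intertwining records and walks\<close>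

text \<open>
  A rank function weighs a threshold with \<open>j\<close> uninspected values below it and \<open>l\<close> above it. Its level is
  \<open>j + l\<close>, the number of uninspected values; the operators below raise the level by one.
\<close>

type_synonym rank_fun = "nat \<Rightarrow> nat \<Rightarrow> nat"

text \<open>
  The effect of one additional value that is ignored. It is one of the \<open>j\<close> values below the threshold
  or one of the \<open>l\<close> values above it.
\<close>

definition insertion :: "rank_fun \<Rightarrow> rank_fun" where
  "insertion f j l = j * f (j - 1) l + l * f j (l - 1)"

text \<open>
  The effect of inspecting one value, summed over all choices of it. For the sign \<open>Pos\<close>, each of the \<open>j\<close> values below the
  threshold is ignored. The value with \<open>p\<close> others between it and the threshold becomes the new
  threshold, at the price of a factor \<open>m\<close> for the record.
\<close>

fun inspection :: "nat \<Rightarrow> sign \<Rightarrow> rank_fun \<Rightarrow> rank_fun" where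
  "inspection m Pos f j l = j * f (j - 1) l + m * (\<Sum>p<l. f (j + p) (l - 1 - p))"
| "inspection m Neg f j l = l * f j (l - 1) + m * (\<Sum>p<j. f (j - 1 - p) (l + p))"

fun rank_weight :: "nat \<Rightarrow> sign list \<Rightarrow> rank_fun" where
  "rank_weight m [] = (\<lambda>j l. of_bool (j = 0 \<and> l = 0))"
| "rank_weight m (s # w) = inspection m s (rank_weight m w)"

definition level_sum :: "nat \<Rightarrow> rank_fun \<Rightarrow> nat" where
  "level_sum k f = (\<Sum>j\<le>k. f j (k - j))"

text \<open>
  The operators interact only through the sum over the new thresholds. There the ignored value may
  lie below or above the new threshold. After a shift of the index in one of the two sums, the
  coefficients of the same term add up to \<open>j + l\<close>, whatever the new threshold is.
\<close>

lemma inspection_Pos_insertion: "inspection m Pos (insertion f) = insertion (inspection m Pos f)"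
proof (intro ext)
  fix j l
  show "inspection m Pos (insertion f) j l = insertion (inspection m Pos f) j l"
  proof (cases l)
    case 0
    then show ?thesis by (simp add: insertion_def)
  next
    case (Suc l')
    \<comment> \<open>Both sides will turn out to be \<open>(Z + m * (Y + j * X)) + l * (Y + m * X)\<close>.\<close>
    define X where "X = (\<Sum>p<l'. f (j + p) (l' - 1 - p))"
    define Y where "Y = j * f (j - 1) l'"
    define Z where "Z = j * ((j - 1) * f (j - 1 - 1) l)"
    have inserted: "(\<Sum>p<l. insertion f (j + p) (l' - p)) = Y + (j + l) * X"
    proof -
      have below: "(\<Sum>p<l. (j + p) * f (j + p - 1) (l' - p)) =
          Y + (\<Sum>p<l'. (j + p + 1) * f (j + p) (l' - 1 - p))"
        unfolding Suc Y_def by (subst sum.lessThan_Suc_shift) (simp add: algebra_simps)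
      have above: "(\<Sum>p<l. (l' - p) * f (j + p) (l' - p - 1)) =
          (\<Sum>p<l'. (l' - p) * f (j + p) (l' - 1 - p))"
        unfolding Suc by (simp add: algebra_simps)
      have "(\<Sum>p<l'. (j + p + 1) * f (j + p) (l' - 1 - p)) +
          (\<Sum>p<l'. (l' - p) * f (j + p) (l' - 1 - p)) = (j + l) * X"
        unfolding X_def sum_distrib_left sum.distrib[symmetric]
        by (intro sum.cong refl) (simp add: distrib_right[symmetric] Suc)
      then show ?thesis unfolding insertion_def sum.distrib below above by simp
    qed
    have shifted: "j * (\<Sum>p<l. f (j - 1 + p) (l' - p)) = Y + j * X"
    proof (cases j)
      case j: (Suc i)
      have "(\<Sum>p<l. f (i + p) (l' - p)) = f i l' + X"
        unfolding Suc by (subst sum.lessThan_Suc_shift) (simp add: X_def j)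
      then show ?thesis by (simp add: j Y_def distrib_left)
    qed (simp add: Y_def)
    have "inspection m Pos (insertion f) j l =
        j * insertion f (j - 1) l + m * (\<Sum>p<l. insertion f (j + p) (l' - p))"
      by (simp add: Suc)
    also have "j * insertion f (j - 1) l = Z + l * Y"
      by (simp add: insertion_def Suc Y_def Z_def distrib_left mult.left_commute)
    also have "(Z + l * Y) + m * (\<Sum>p<l. insertion f (j + p) (l' - p)) =
        (Z + m * (Y + j * X)) + l * (Y + m * X)"
      unfolding inserted by (simp add: algebra_simps)
    also have "Z + m * (Y + j * X) = j * inspection m Pos f (j - 1) l"
      unfolding shifted[symmetric] by (simp add: Suc Z_def distrib_left mult.left_commute)
    also have "Y + m * X = inspection m Pos f j (l - 1)"
      by (simp add: Suc X_def Y_def)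
    finally show ?thesis by (simp add: insertion_def)
  qed
qed

text \<open>
  Reversing the order of the values exchanges the two signs.
\<close>

lemma inspection_Neg: "inspection m Neg f j l = inspection m Pos (\<lambda>a b. f b a) l j"
  by (simp add: add.commute)

lemma inspection_insertion: "inspection m s (insertion f) = insertion (inspection m s f)"
proof (cases s)
  case Pos
  then show ?thesis using inspection_Pos_insertion by blast
next
  case Neg
  define g where "g = (\<lambda>a b. f b a)"
  have swap: "(\<lambda>a b. insertion f b a) = insertion g"
    by (simp add: insertion_def g_def fun_eq_iff)
  have "inspection m Neg (insertion f) j l = insertion (inspection m Neg f) j l" for j l
  proof -
    have "inspection m Neg (insertion f) j l = insertion (inspection m Pos g) l j"
      by (simp only: inspection_Neg[of m "insertion f"] swap inspection_Pos_insertion)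
    also have "\<dots> = insertion (inspection m Neg f) j l"
      by (simp only: insertion_def inspection_Neg[of m f] g_def[symmetric] add.commute)
    finally show ?thesis .
  qed
  then show ?thesis unfolding Neg by (intro ext)
qed

text \<open>
  The vector of walk counts as a rank function of level \<open>m - 1\<close>. The entry with index \<open>Suc j\<close> sits at the
  pair with \<open>j\<close> values below the threshold.
\<close>

definition walk_vector :: "nat \<Rightarrow> sign list \<Rightarrow> rank_fun" where
  "walk_vector m w j l = (if Suc (j + l) = m then walks_from m w (Suc j) else 0)"

text \<open>
  At level \<open>m\<close> the numbers \<open>j\<close> and \<open>l\<close> add up to the record weight \<open>m\<close>. So the factor \<open>m\<close> in front of the
  sum over the new thresholds splits into the two coefficients of an insertion. This is where it
  matters that the weight of a record equals the number of values available to a map.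
\<close>

lemma inspection_walk_vector: "inspection m s (walk_vector m w) = insertion (walk_vector m (s # w))"
proof (intro ext)
  fix j l
  show "inspection m s (walk_vector m w) j l = insertion (walk_vector m (s # w)) j l"
  proof (cases "j + l = m")
    case False
    have 1: "(\<Sum>p<l. walk_vector m w (j + p) (l - 1 - p)) = 0"
      using False by (intro sum.neutral) (simp add: walk_vector_def)
    have 2: "(\<Sum>p<j. walk_vector m w (j - 1 - p) (l + p)) = 0"
      using False by (intro sum.neutral) (simp add: walk_vector_def)
    have 3: "j * walk_vector m u (j - 1) l = 0" "l * walk_vector m u j (l - 1) = 0" for u
      using False by (auto simp: walk_vector_def)
    show ?thesis by (cases s) (simp_all only: inspection.simps insertion_def 1 2 3)
  next
    case m: True
    let ?r = "walks_from m w"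
    have r: "walks_from m (s # w) a = (\<Sum>c\<in>{c\<in>{1..m}. leq s a c}. ?r c)" for a
      unfolding walks_from_Cons by (intro sum.mono_neutral_cong_right) auto
    have E: "insertion (walk_vector m (s # w)) j l =
        j * walks_from m (s # w) j + l * walks_from m (s # w) (Suc j)"
      using m by (auto simp: insertion_def walk_vector_def)
    show ?thesis
    proof (cases s)
      case Pos
      have "(\<Sum>p<l. walk_vector m w (j + p) (l - 1 - p)) = (\<Sum>p<l. ?r (Suc (j + p)))"
        using m by (intro sum.cong) (auto simp: walk_vector_def)
      also have "\<dots> = sum ?r {c\<in>{1..m}. Suc j \<le> c}"
        by (rule sum.reindex_bij_witness[of _ "\<lambda>c. c - Suc j" "\<lambda>p. Suc (j + p)"]) (use m in auto)
      finally have L: "inspection m s (walk_vector m w) j l = j * ?r j + m * sum ?r {c\<in>{1..m}. Suc j \<le> c}"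
        using m by (cases j) (auto simp: Pos walk_vector_def)
      have "j * sum ?r {c\<in>{1..m}. j \<le> c} = j * (?r j + sum ?r {c\<in>{1..m}. Suc j \<le> c})"
      proof (cases "j = 0")
        case False
        then have "{c\<in>{1..m}. j \<le> c} = insert j {c\<in>{1..m}. Suc j \<le> c}" using m by auto
        then show ?thesis by simp
      qed simp
      then show ?thesis unfolding L E r unfolding Pos using m by (auto simp: algebra_simps)
    next
      case Neg
      have "(\<Sum>p<j. walk_vector m w (j - 1 - p) (l + p)) = (\<Sum>p<j. ?r (j - p))"
        using m by (intro sum.cong) (auto simp: walk_vector_def Suc_diff_Suc)
      also have "\<dots> = sum ?r {c\<in>{1..m}. c \<le> j}"
        by (rule sum.reindex_bij_witness[of _ "\<lambda>c. j - c" "\<lambda>p. j - p"]) (use m in auto)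
      finally have L: "inspection m s (walk_vector m w) j l = l * ?r (Suc j) + m * sum ?r {c\<in>{1..m}. c \<le> j}"
        using m by (cases l) (auto simp: Neg walk_vector_def)
      have "l * sum ?r {c\<in>{1..m}. c \<le> Suc j} = l * (?r (Suc j) + sum ?r {c\<in>{1..m}. c \<le> j})"
      proof (cases "l = 0")
        case False
        then have "{c\<in>{1..m}. c \<le> Suc j} = insert (Suc j) {c\<in>{1..m}. c \<le> j}" using m by auto
        then show ?thesis by simp
      qed simp
      then show ?thesis unfolding L E r unfolding Neg using m by (auto simp: algebra_simps)
    qed
  qed
qed

lemma inspection_scale: "inspection m s (\<lambda>j l. c * f j l) = (\<lambda>j l. c * inspection m s f j l)"
  by (cases s) (auto simp: fun_eq_iff algebra_simps sum_distrib_left)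

lemma inspection_insertion_power:
  "inspection m s ((insertion ^^ i) f) = (insertion ^^ i) (inspection m s f)"
  by (induction i) (simp_all add: inspection_insertion)

lemma insertion_power_indicator:
  "(insertion ^^ i) (\<lambda>j l. of_bool (j = 0 \<and> l = 0)) = (\<lambda>j l. fact i * of_bool (j + l = i))"
proof (induction i)
  case (Suc i)
  have "insertion (\<lambda>j l. fact i * of_bool (j + l = i)) j l = fact (Suc i) * of_bool (j + l = Suc i)" for j l
  proof -
    have "j * of_bool (j - 1 + l = i) = j * of_bool (j + l = Suc i)"
      and "l * of_bool (j + (l - 1) = i) = l * of_bool (j + l = Suc i)"
      by (cases j, simp_all) (cases l, simp_all)
    then have "insertion (\<lambda>j l. fact i * of_bool (j + l = i)) j l = fact i * ((j + l) * of_bool (j + l = Suc i))"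
      unfolding insertion_def by (metis distrib_left distrib_right mult.left_commute)
    also have "\<dots> = fact (Suc i) * of_bool (j + l = Suc i)"
      by (cases "j + l = Suc i") simp_all
    finally show ?thesis .
  qed
  then show ?case by (simp only: funpow.simps comp_apply Suc.IH)
qed (auto simp: fun_eq_iff)

text \<open>
  Both sides start from the only function of level \<open>0\<close>, which \<open>k\<close> insertions turn into \<open>k!\<close> times the
  vector of ones. Every letter then acts in the same way on both sides, since the operators commute.
\<close>

lemma insertion_rank_weight:
  "(insertion ^^ k) (rank_weight (Suc k) w) =
   (\<lambda>j l. fact k * (insertion ^^ length w) (walk_vector (Suc k) w) j l)"
proof (induction w)
  case Nil
  have row: "walk_vector (Suc k) [] = (\<lambda>j l. of_bool (j + l = k))"
    by (intro ext) (simp add: walk_vector_def walks_from_Nil)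
  show ?case
    by (simp only: rank_weight.simps insertion_power_indicator list.size funpow_0 row)
next
  case (Cons s w)
  have "(insertion ^^ k) (rank_weight (Suc k) (s # w)) =
      inspection (Suc k) s ((insertion ^^ k) (rank_weight (Suc k) w))"
    by (simp only: rank_weight.simps inspection_insertion_power)
  also have "\<dots> = (\<lambda>j l. fact k * inspection (Suc k) s ((insertion ^^ length w) (walk_vector (Suc k) w)) j l)"
    by (simp only: Cons.IH inspection_scale)
  also have "inspection (Suc k) s ((insertion ^^ length w) (walk_vector (Suc k) w)) =
      (insertion ^^ length (s # w)) (walk_vector (Suc k) (s # w))"
    by (simp only: inspection_insertion_power inspection_walk_vector list.size funpow_Suc_right comp_apply
        add_0_right add_Suc_right)
  finally show ?case .
qed

text \<open>
  A value can be inserted into a sequence of \<open>k\<close> values and a threshold in \<open>k + 2\<close> places.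
\<close>

lemma level_sum_insertion: "level_sum (Suc k) (insertion f) = (k + 2) * level_sum k f"
proof -
  have "level_sum (Suc k) (insertion f) =
      (\<Sum>j\<le>Suc k. j * f (j - 1) (Suc k - j)) + (\<Sum>j\<le>Suc k. (Suc k - j) * f j (Suc k - j - 1))"
    by (simp only: level_sum_def insertion_def sum.distrib)
  also have "(\<Sum>j\<le>Suc k. j * f (j - 1) (Suc k - j)) = (\<Sum>j\<le>k. Suc j * f j (k - j))"
    by (subst sum.atMost_Suc_shift) simp
  also have "(\<Sum>j\<le>Suc k. (Suc k - j) * f j (Suc k - j - 1)) = (\<Sum>j\<le>k. (Suc k - j) * f j (k - j))"
    by simp
  also have "(\<Sum>j\<le>k. Suc j * f j (k - j)) + (\<Sum>j\<le>k. (Suc k - j) * f j (k - j)) = (k + 2) * level_sum k f"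
    unfolding level_sum_def sum_distrib_left sum.distrib[symmetric]
    by (intro sum.cong refl) (simp add: distrib_right[symmetric] del: mult_Suc)
  finally show ?thesis .
qed

lemma level_sum_insertion_power:
  "fact (Suc k) * level_sum (k + i) ((insertion ^^ i) f) = fact (Suc (k + i)) * level_sum k f"
proof (induction i)
  case (Suc i)
  define c where "c = k + i + 2"
  have "level_sum (k + Suc i) ((insertion ^^ Suc i) f) = c * level_sum (k + i) ((insertion ^^ i) f)"
    by (simp only: c_def add_Suc_right funpow.simps comp_apply level_sum_insertion)
  then have "fact (Suc k) * level_sum (k + Suc i) ((insertion ^^ Suc i) f) =
      c * (fact (Suc k) * level_sum (k + i) ((insertion ^^ i) f))"
    by (simp only: mult.left_commute)
  also have "\<dots> = (c * fact (Suc (k + i))) * level_sum k f"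
    by (simp only: Suc.IH mult.assoc)
  also have "c * fact (Suc (k + i)) = fact (Suc (k + Suc i))"
    by (simp only: c_def add_Suc_right fact_Suc[of "Suc (k + i)"] of_nat_id add_2_eq_Suc')
  finally show ?case .
qed (simp only: funpow_0 add_0_right)

text \<open>
  Take the level sums on both sides of \<open>insertion_rank_weight\<close>. Each insertion
  multiplies them by a known factor, and cancelling the factors leaves a factorial.
\<close>

lemma level_sum_rank_weight:
  assumes "m > 0"
  shows "m * level_sum (length w) (rank_weight m w) = fact (Suc (length w)) * all_walks m w"
proof -
  obtain k where m: "m = Suc k" using assms gr0_implies_Suc by blast
  define n where "n = length w"
  have "level_sum k (walk_vector m w) = (\<Sum>j<m. walks_from m w (Suc j))"
    unfolding level_sum_def m lessThan_Suc_atMost by (intro sum.cong) (auto simp: walk_vector_def)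
  also have "\<dots> = all_walks m w"
    unfolding all_walks_def by (rule sum.reindex_bij_witness[of _ "\<lambda>a. a - 1" Suc]) auto
  finally have tot: "level_sum k (walk_vector m w) = all_walks m w" .
  have "fact (Suc (n + k)) * level_sum n (rank_weight m w) =
      fact (Suc n) * level_sum (n + k) ((insertion ^^ k) (rank_weight m w))"
    by (rule level_sum_insertion_power[symmetric])
  also have "\<dots> = fact (Suc n) * (fact k * level_sum (k + n) ((insertion ^^ n) (walk_vector m w)))"
    by (simp add: m insertion_rank_weight level_sum_def sum_distrib_left n_def add.commute del: fact_Suc)
  finally have *: "fact (Suc (n + k)) * level_sum n (rank_weight m w) =
      fact (Suc n) * (fact k * level_sum (k + n) ((insertion ^^ n) (walk_vector m w)))" .
  define Y where "Y = level_sum (k + n) ((insertion ^^ n) (walk_vector m w))"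
  have "fact (Suc (n + k)) * (m * level_sum n (rank_weight m w)) =
      m * (fact (Suc (n + k)) * level_sum n (rank_weight m w))"
    by (rule mult.left_commute)
  also have "\<dots> = fact (Suc n) * (m * (fact k * Y))"
    unfolding * Y_def by (rule mult.left_commute)
  also have "m * (fact k * Y) = fact (Suc k) * Y"
    unfolding m fact_Suc of_nat_id by (rule mult.assoc[symmetric])
  also have "fact (Suc k) * Y = fact (Suc (n + k)) * all_walks m w"
    unfolding Y_def tot[symmetric] add.commute[of n k] by (rule level_sum_insertion_power)
  also have "fact (Suc n) * (fact (Suc (n + k)) * all_walks m w) =
      fact (Suc (n + k)) * (fact (Suc n) * all_walks m w)"
    by (rule mult.left_commute)
  finally have "m * level_sum n (rank_weight m w) = fact (Suc n) * all_walks m w"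
    by (rule mult_left_cancel[OF fact_nonzero, THEN iffD1])
  then show ?thesis by (simp only: n_def)
qed

section \<open>Records of random arrangements\<close>

lemma sum_permutations_of_set_Cons:
  assumes "S \<noteq> {}"
  shows "(\<Sum>vs\<in>permutations_of_set S. g vs) = (\<Sum>x\<in>S. \<Sum>vs\<in>permutations_of_set (S - {x}). g (x # vs))"
proof (cases "finite S")
  case True
  have "permutations_of_set S = (\<Union>x\<in>S. (#) x ` permutations_of_set (S - {x}))"
    using assms by (rule permutations_of_set_nonempty)
  then have "(\<Sum>vs\<in>permutations_of_set S. g vs) =
      (\<Sum>x\<in>S. \<Sum>vs\<in>(#) x ` permutations_of_set (S - {x}). g vs)"
    using True by (simp only:) (rule sum.UNION_disjoint, auto)
  then show ?thesis by (simp add: sum.reindex)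
qed (simp add: permutations_of_set_infinite)

lemma sum_over_ranks:
  fixes T :: "nat set"
  assumes "finite T"
  shows "(\<Sum>x\<in>T. g (card {y\<in>T. y < x}) (card {y\<in>T. x < y})) = (\<Sum>p<card T. g p (card T - 1 - p))"
proof -
  define below where "below x = {y\<in>T. y < x}" for x
  have fin: "finite (below x)" for x using assms by (simp add: below_def)
  have sub: "below x \<subset> below x'" if "x \<in> T" "x < x'" for x x'
  proof (rule psubsetI)
    show "below x \<subseteq> below x'" using that by (auto simp: below_def)
    show "below x \<noteq> below x'" using that by (metis (no_types, lifting) below_def less_irrefl mem_Collect_eq)
  qed
  have less: "card (below x) < card (below x')" if "x \<in> T" "x < x'" for x x'
    by (rule psubset_card_mono[OF fin sub[OF that]])
  have inj: "inj_on (\<lambda>x. card (below x)) T"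
    using less by (intro inj_onI) (metis less_irrefl linorder_neqE_nat)
  have "(\<lambda>x. card (below x)) ` T \<subseteq> {..<card T}"
  proof (rule image_subsetI)
    fix x assume "x \<in> T"
    then have "below x \<subset> T" by (auto simp: below_def)
    then show "card (below x) \<in> {..<card T}" using assms psubset_card_mono by blast
  qed
  then have "(\<lambda>x. card (below x)) ` T = {..<card T}"
    using inj by (intro card_subset_eq) (simp_all add: card_image)
  then have bij: "bij_betw (\<lambda>x. card (below x)) T {..<card T}"
    using inj by (simp add: bij_betw_def)
  have "card {y\<in>T. x < y} = card T - 1 - card (below x)" if "x \<in> T" for x
  proof -
    have "T = below x \<union> insert x {y\<in>T. x < y}"
      using that by (auto simp: below_def intro: linorder_neqE_nat)
    then have "card T = card (below x \<union> insert x {y\<in>T. x < y})" by (rule arg_cong)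
    also have "card (below x \<union> insert x {y\<in>T. x < y}) = card (below x) + card (insert x {y\<in>T. x < y})"
      using assms by (intro card_Un_disjoint) (auto simp: below_def)
    also have "card (insert x {y\<in>T. x < y}) = Suc (card {y\<in>T. x < y})"
      using assms by simp
    finally show ?thesis by simp
  qed
  then have "(\<Sum>x\<in>T. g (card {y\<in>T. y < x}) (card {y\<in>T. x < y})) =
      (\<Sum>x\<in>T. g (card (below x)) (card T - 1 - card (below x)))"
    by (intro sum.cong refl) (simp only: below_def)
  also have "\<dots> = (\<Sum>p<card T. g p (card T - 1 - p))"
    by (rule sum.reindex_bij_betw[OF bij])
  finally show ?thesis .
qed

text \<open>
  The records depend only on the relative order of the values, so the sum is governed by the ranks of
  the threshold among the values, and it satisfies the recursion of \<^const>\<open>inspection\<close>.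
\<close>

lemma sum_records_permutations:
  assumes "finite S" "h \<notin> S" "card S = length w"
  shows "(\<Sum>vs\<in>permutations_of_set S. m ^ records (zip w vs) h) =
         rank_weight m w (card {y\<in>S. y < h}) (card {y\<in>S. h < y})"
  using assms
proof (induction w arbitrary: S h)
  case Nil
  then show ?case by simp
next
  case (Cons s w)
  define B where "B = {y\<in>S. y < h}"
  define A where "A = {y\<in>S. h < y}"
  have S: "S = B \<union> A" "B \<inter> A = {}" and finBA: "finite B" "finite A"
    using Cons.prems by (auto simp: A_def B_def intro: linorder_neqE_nat)
  have "S \<noteq> {}" using Cons.prems by auto
  define W where "W = rank_weight m w"
  define c where "c x = (if update (s, x) h = h then W (card {y\<in>S - {x}. y < h}) (card {y\<in>S - {x}. h < y})
    else m * W (card {y\<in>S. y < x}) (card {y\<in>S. x < y}))" for x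
  have "(\<Sum>vs\<in>permutations_of_set (S - {x}). m ^ records (zip (s # w) (x # vs)) h) = c x"
    if "x \<in> S" for x
  proof -
    have card: "finite (S - {x})" "card (S - {x}) = length w" using Cons.prems that by auto
    show ?thesis
    proof (cases "update (s, x) h = h")
      case True
      then show ?thesis
        using Cons.IH[OF card(1) _ card(2), of h] \<open>h \<notin> S\<close> by (simp add: c_def W_def)
    next
      case False
      then have x: "update (s, x) h = x" by (cases s) (simp_all add: max_def min_def split: if_splits)
      have "{y\<in>S - {x}. y < x} = {y\<in>S. y < x}" "{y\<in>S - {x}. x < y} = {y\<in>S. x < y}" by auto
      then have "(\<Sum>vs\<in>permutations_of_set (S - {x}). m ^ records (zip w vs) x) =
          W (card {y\<in>S. y < x}) (card {y\<in>S. x < y})"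
        using Cons.IH[OF card(1) _ card(2), of x] by (simp only: W_def) simp
      moreover have "m ^ records (zip (s # w) (x # vs)) h = m * m ^ records (zip w vs) x" for vs
        using False by (simp add: x)
      ultimately show ?thesis
        using False by (simp only: c_def sum_distrib_left[symmetric] if_False)
    qed
  qed
  then have "(\<Sum>vs\<in>permutations_of_set S. m ^ records (zip (s # w) vs) h) = (\<Sum>x\<in>S. c x)"
    by (simp add: sum_permutations_of_set_Cons[OF \<open>S \<noteq> {}\<close>])
  also have "\<dots> = (\<Sum>x\<in>B. c x) + (\<Sum>x\<in>A. c x)"
    unfolding S(1) using finBA S(2) by (rule sum.union_disjoint)
  also have "\<dots> = inspection m s W (card B) (card A)"
  proof (cases s)
    case Pos
    have "c x = W (card B - 1) (card A)" if "x \<in> B" for x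
    proof -
      have "{y\<in>S - {x}. y < h} = B - {x}" "{y\<in>S - {x}. h < y} = A" using that by (auto simp: A_def B_def)
      moreover have "update (s, x) h = h" using that by (simp add: Pos B_def)
      moreover have "card (B - {x}) = card B - 1" using that by (rule card_Diff_singleton)
      ultimately show ?thesis by (simp only: c_def simp_thms if_True)
    qed
    moreover have "c x = m * W (card B + card {y\<in>A. y < x}) (card {y\<in>A. x < y})" if "x \<in> A" for x
    proof -
      have "{y\<in>S. y < x} = B \<union> {y\<in>A. y < x}"
        using that \<open>h \<notin> S\<close> by (auto simp: A_def B_def intro: linorder_neqE_nat)
      moreover have "card (B \<union> {y\<in>A. y < x}) = card B + card {y\<in>A. y < x}"
        using finBA S(2) by (intro card_Un_disjoint) auto
      moreover have "{y\<in>S. x < y} = {y\<in>A. x < y}"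
        using that by (auto simp: A_def B_def)
      moreover have "update (s, x) h \<noteq> h" using that by (simp add: Pos A_def)
      ultimately show ?thesis by (simp only: c_def if_False)
    qed
    ultimately show ?thesis
      using sum_over_ranks[OF finBA(2), of "\<lambda>a b. m * W (card B + a) b"]
      by (simp add: Pos sum_distrib_left)
  next
    case Neg
    have "c x = W (card B) (card A - 1)" if "x \<in> A" for x
    proof -
      have "{y\<in>S - {x}. h < y} = A - {x}" "{y\<in>S - {x}. y < h} = B" using that by (auto simp: A_def B_def)
      moreover have "update (s, x) h = h" using that by (simp add: Neg A_def)
      moreover have "card (A - {x}) = card A - 1" using that by (rule card_Diff_singleton)
      ultimately show ?thesis by (simp only: c_def simp_thms if_True)
    qed
    moreover have "c x = m * W (card {y\<in>B. y < x}) (card A + card {y\<in>B. x < y})" if "x \<in> B" for x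
    proof -
      have "{y\<in>S. x < y} = A \<union> {y\<in>B. x < y}"
        using that \<open>h \<notin> S\<close> by (auto simp: A_def B_def intro: linorder_neqE_nat)
      moreover have "card (A \<union> {y\<in>B. x < y}) = card A + card {y\<in>B. x < y}"
        using finBA S(2) by (intro card_Un_disjoint) auto
      moreover have "{y\<in>S. y < x} = {y\<in>B. y < x}"
        using that by (auto simp: A_def B_def)
      moreover have "update (s, x) h \<noteq> h" using that by (simp add: Neg B_def)
      ultimately show ?thesis by (simp only: c_def if_False)
    qed
    ultimately have A: "(\<Sum>x\<in>A. c x) = card A * W (card B) (card A - 1)"
      and B: "(\<Sum>x\<in>B. c x) =
        (\<Sum>x\<in>B. m * W (card {y\<in>B. y < x}) (card A + card {y\<in>B. x < y}))"
      by simp_all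
    note B
    also have "(\<Sum>x\<in>B. m * W (card {y\<in>B. y < x}) (card A + card {y\<in>B. x < y})) =
        (\<Sum>p<card B. m * W p (card A + (card B - 1 - p)))"
      by (rule sum_over_ranks[OF finBA(1), of "\<lambda>a b. m * W a (card A + b)"])
    also have "\<dots> = (\<Sum>p<card B. m * W (card B - 1 - p) (card A + p))"
    proof -
      have "card B - 1 - (card B - Suc p) = p" "card B - Suc p = card B - 1 - p" if "p < card B" for p
        using that by simp_all
      then show ?thesis
        by (subst sum.nat_diff_reindex[symmetric]) (intro sum.cong refl, simp only: lessThan_iff)
    qed
    finally show ?thesis
      unfolding Neg inspection.simps sum_distrib_left A by (simp only: add.commute)
  qed
  finally show ?case by (simp only: A_def B_def W_def rank_weight.simps)
qed

text \<open>
  The linear analogue of the theorem. The value \<open>v\<close> at the position where the cycle is cut is the first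
  record and the initial threshold.
\<close>

lemma sum_records_from_first:
  assumes "finite S" "card S = Suc (length w)" "m > 0"
  shows "(\<Sum>v\<in>S. \<Sum>vs\<in>permutations_of_set (S - {v}). m ^ Suc (records (zip w vs) v)) =
         fact (card S) * all_walks m w"
proof -
  have "(\<Sum>vs\<in>permutations_of_set (S - {v}). m ^ Suc (records (zip w vs) v)) =
      m * rank_weight m w (card {y\<in>S. y < v}) (card {y\<in>S. v < y})" if "v \<in> S" for v
  proof -
    have "finite (S - {v})" "v \<notin> S - {v}" "card (S - {v}) = length w"
      using assms that by simp_all
    then have "(\<Sum>vs\<in>permutations_of_set (S - {v}). m ^ records (zip w vs) v) =
        rank_weight m w (card {y\<in>S - {v}. y < v}) (card {y\<in>S - {v}. v < y})"
      by (rule sum_records_permutations)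
    moreover have "{y\<in>S - {v}. y < v} = {y\<in>S. y < v}" "{y\<in>S - {v}. v < y} = {y\<in>S. v < y}" by auto
    ultimately show ?thesis by (simp only: power_Suc sum_distrib_left[symmetric])
  qed
  then have "(\<Sum>v\<in>S. \<Sum>vs\<in>permutations_of_set (S - {v}). m ^ Suc (records (zip w vs) v)) =
      (\<Sum>v\<in>S. m * rank_weight m w (card {y\<in>S. y < v}) (card {y\<in>S. v < y}))"
    by (rule sum.cong[OF refl])
  also have "\<dots> = (\<Sum>p<card S. m * rank_weight m w p (card S - 1 - p))"
    by (rule sum_over_ranks[OF assms(1), of "\<lambda>a b. m * rank_weight m w a b"])
  also have "\<dots> = m * level_sum (length w) (rank_weight m w)"
    by (simp only: assms(2) level_sum_def sum_distrib_left lessThan_Suc_atMost diff_Suc_1)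
  also have "\<dots> = fact (card S) * all_walks m w"
    by (simp only: level_sum_rank_weight[OF assms(3)] assms(2))
  finally show ?thesis .
qed

section \<open>The recursion for cyclic words\<close>

text \<open>
  Arbitrary sets \<open>S\<close> of values are allowed because deleting a position also deletes its value.
\<close>

definition cyclic_sum :: "nat \<Rightarrow> sign list \<Rightarrow> nat set \<Rightarrow> nat" where
  "cyclic_sum m w S = (\<Sum>vs\<in>permutations_of_set S. m ^ cyclic_records (zip w vs))"

lemma cyclic_sum_rotate:
  assumes "finite S" "card S = length (u @ v)"
  shows "cyclic_sum m (u @ v) S = cyclic_sum m (v @ u) S"
  unfolding cyclic_sum_def
proof (rule sum.reindex_bij_witness[of _ "rotate (length v)" "rotate (length u)"])
  fix vs assume "vs \<in> permutations_of_set S"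
  then have len: "length vs = length (u @ v)"
    using assms by (metis distinct_card permutations_of_setD)
  have "rotate (length v) (rotate (length u) vs) = rotate (length vs) vs"
    by (simp only: rotate_rotate len length_append add.commute)
  then show "rotate (length v) (rotate (length u) vs) = vs" by simp
  show "rotate (length u) vs \<in> permutations_of_set S"
    using \<open>vs \<in> permutations_of_set S\<close> by (simp add: permutations_of_set_def)
  obtain xs ys where vs: "vs = xs @ ys" "length xs = length u" "length ys = length v"
    using len by (metis append_take_drop_id length_append length_drop length_take add_diff_cancel_left' min.absorb2 le_add1)
  then have "rotate (length u) vs = ys @ xs" by (metis rotate_append)
  then show "m ^ cyclic_records (zip (v @ u) (rotate (length u) vs)) = m ^ cyclic_records (zip (u @ v) vs)"
    using vs cyclic_records_rotate by simp
next
  fix vs assume "vs \<in> permutations_of_set S"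
  then have len: "length vs = length (u @ v)"
    using assms by (metis distinct_card permutations_of_setD)
  have "rotate (length u) (rotate (length v) vs) = rotate (length vs) vs"
    by (simp only: rotate_rotate len length_append)
  then show "rotate (length u) (rotate (length v) vs) = vs" by simp
  show "rotate (length v) vs \<in> permutations_of_set S"
    using \<open>vs \<in> permutations_of_set S\<close> by (simp add: permutations_of_set_def)
qed

lemma cyclic_sum_flip:
  assumes "finite S" "card S = Suc (length w)" "0 \<notin> S" "m > 0"
  shows "cyclic_sum m (Pos # w) S + cyclic_sum m (Neg # w) S =
         (\<Sum>v\<in>S. cyclic_sum m w (S - {v})) + fact (card S) * all_walks m w"
proof -
  have "S \<noteq> {}" using assms(2) by auto
  have "cyclic_sum m (Pos # w) S + cyclic_sum m (Neg # w) S =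
      (\<Sum>v\<in>S. \<Sum>vs\<in>permutations_of_set (S - {v}).
        m ^ cyclic_records ((Pos, v) # zip w vs) + m ^ cyclic_records ((Neg, v) # zip w vs))"
    unfolding cyclic_sum_def sum_permutations_of_set_Cons[OF \<open>S \<noteq> {}\<close>] by (simp add: sum.distrib)
  also have "\<dots> = (\<Sum>v\<in>S. \<Sum>vs\<in>permutations_of_set (S - {v}).
        m ^ cyclic_records (zip w vs) + m ^ Suc (records (zip w vs) v))"
  proof (intro sum.cong refl)
    fix v vs assume v: "v \<in> S" and vs: "vs \<in> permutations_of_set (S - {v})"
    have "snd ` set (zip w vs) \<subseteq> set vs" by (auto dest: set_zip_rightD)
    also have "set vs = S - {v}" using vs by (rule permutations_of_setD)
    finally have "v \<notin> snd ` set (zip w vs)" by blast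
    moreover have "v > 0" using v assms(3) by (metis gr0I)
    ultimately have "cyclic_records ((Pos, v) # zip w vs) = Suc (records (zip w vs) v) \<and>
        cyclic_records ((Neg, v) # zip w vs) = cyclic_records (zip w vs) \<or>
        cyclic_records ((Pos, v) # zip w vs) = cyclic_records (zip w vs) \<and>
        cyclic_records ((Neg, v) # zip w vs) = Suc (records (zip w vs) v)"
      by (rule cyclic_records_flip)
    then show "m ^ cyclic_records ((Pos, v) # zip w vs) + m ^ cyclic_records ((Neg, v) # zip w vs) =
        m ^ cyclic_records (zip w vs) + m ^ Suc (records (zip w vs) v)"
      by (elim disjE conjE) (simp_all only: add.commute)
  qed
  also have "\<dots> = (\<Sum>v\<in>S. cyclic_sum m w (S - {v})) + fact (card S) * all_walks m w"
    unfolding sum_records_from_first[OF assms(1,2,4), symmetric] cyclic_sum_def by (simp only: sum.distrib)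
  finally show ?thesis .
qed

text \<open>
  The recursions \<open>cyclic_sum_flip\<close> and \<open>closed_walks_flip\<close> agree: deleting a position leaves one of
  \<open>card S\<close> sets with one value less, which turns \<open>(card S - 1)!\<close> into \<open>(card S)!\<close>. The outer induction is
  on the length of the word, the inner one on the number of its letters \<open>Neg\<close>.
\<close>

lemma cyclic_sum_eq_closed_walks:
  assumes "finite S" "card S = length w" "0 \<notin> S" "m > 0"
  shows "cyclic_sum m w S = fact (card S) * closed_walks m w"
  using assms(1-3)
proof (induction "length w" arbitrary: w S)
  case 0
  then show ?case by (simp add: cyclic_sum_def cyclic_records_def closed_walks_def)
next
  case (Suc n)
  note IH = Suc.hyps(1)
  show ?case using Suc.hyps(2) Suc.prems
  proof (induction "count_list w Neg" arbitrary: w)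
    case 0
    then have Pos: "s = Pos" if "s \<in> set w" for s
      using that by (metis count_list_0_iff sign.exhaust)
    have "cyclic_records (zip w vs) = 1" for vs
      using Pos by (intro cyclic_records_all_Pos) (auto dest: set_zip_leftD)
    then show ?case
      using 0 by (simp add: cyclic_sum_def closed_walks_all_Pos[OF Pos])
  next
    case (Suc k)
    from Suc.hyps(2) have "Neg \<in> set w" by (metis count_list_0_iff nat.distinct(1))
    then obtain u v where w: "w = u @ Neg # v" by (meson split_list)
    \<comment> \<open>\<open>w\<close> is a rotation of \<open>Neg # w'\<close>, and \<open>Pos # w'\<close> has one \<open>Neg\<close> less.\<close>
    define w' where "w' = v @ u"
    have len: "n = length w'" "card S = Suc (length w')" using Suc.prems by (auto simp: w w'_def)
    have "cyclic_sum m w S = cyclic_sum m (Neg # w') S"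
      using cyclic_sum_rotate[of S u "Neg # v" m] Suc.prems by (simp add: w w'_def)
    moreover have "closed_walks m w = closed_walks m (Neg # w')"
      using closed_walks_rotate[of m u "Neg # v"] by (simp add: w w'_def)
    moreover have "cyclic_sum m (Pos # w') S = fact (card S) * closed_walks m (Pos # w')"
      using Suc.hyps(2) Suc.prems len by (intro Suc.hyps(1)) (auto simp: w w'_def)
    moreover have "(\<Sum>v\<in>S. cyclic_sum m w' (S - {v})) = fact (card S) * closed_walks m w'"
    proof -
      have "cyclic_sum m w' (S - {v}) = fact (length w') * closed_walks m w'" if "v \<in> S" for v
        using IH[of w' "S - {v}"] len Suc.prems that by simp
      then show ?thesis using len by (simp add: distrib_right)
    qed
    ultimately show ?case
      using cyclic_sum_flip[of S w' m] closed_walks_flip[of m w'] len Suc.prems assms(4)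
      by (metis add_left_cancel distrib_left)
  qed
qed

section \<open>Order-preserving maps as closed walks\<close>

text \<open>
  Positions are inspected in descending order, so the word lists the signs in this order.
\<close>

abbreviation word :: "nat \<Rightarrow> (nat \<Rightarrow> sign) \<Rightarrow> sign list" where
  "word n \<eta> \<equiv> map \<eta> (rev [1..<Suc n])"

lemma monotone_cyc_order_iff:
  "monotone_on {1..n} (\<lambda>x y. (x, y) \<in> cyc_order n \<eta>) (\<le>) f \<longleftrightarrow>
   (\<forall>i\<in>{1..n}. leq (\<eta> i) (f (cyc_succ n i)) (f i))" for f :: "nat \<Rightarrow> nat"
proof
  assume mono: "monotone_on {1..n} (\<lambda>x y. (x, y) \<in> cyc_order n \<eta>) (\<le>) f"
  show "\<forall>i\<in>{1..n}. leq (\<eta> i) (f (cyc_succ n i)) (f i)"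
  proof
    fix i assume i: "i \<in> {1..n}"
    then have i': "cyc_succ n i \<in> {1..n}" by (auto simp: cyc_succ_def)
    show "leq (\<eta> i) (f (cyc_succ n i)) (f i)"
    proof (cases "\<eta> i")
      case Pos
      then have "(cyc_succ n i, i) \<in> cyc_order n \<eta>" using i by (auto simp: cyc_order_def cyc_gen_def)
      then show ?thesis using monotone_onD[OF mono i' i] Pos by simp
    next
      case Neg
      then have "(i, cyc_succ n i) \<in> cyc_order n \<eta>" using i by (auto simp: cyc_order_def cyc_gen_def)
      then show ?thesis using monotone_onD[OF mono i i'] Neg by simp
    qed
  qed
next
  assume leq: "\<forall>i\<in>{1..n}. leq (\<eta> i) (f (cyc_succ n i)) (f i)"
  have gen: "f x \<le> f y" if "(x, y) \<in> cyc_gen n \<eta>" for x y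
    using that leq by (force simp: cyc_gen_def)
  have "f x \<le> f y" if "(x, y) \<in> (cyc_gen n \<eta>)\<^sup>+" for x y
    using that by (induction rule: trancl_induct) (auto intro: gen order_trans)
  then show "monotone_on {1..n} (\<lambda>x y. (x, y) \<in> cyc_order n \<eta>) (\<le>) f"
    by (auto simp: monotone_on_def cyc_order_def)
qed

text \<open>
  The maps on the path \<open>1, \<dots>, n\<close> that prolong a map with value \<open>a\<close> at the position after \<open>n\<close> and have
  the value \<open>b\<close> at \<open>1\<close>. They close up to maps on the cycle if \<open>a = b\<close>.
\<close>

definition path_maps :: "nat \<Rightarrow> (nat \<Rightarrow> sign) \<Rightarrow> nat \<Rightarrow> nat \<Rightarrow> nat \<Rightarrow> (nat \<Rightarrow> nat) set" where
  "path_maps n \<eta> m a b =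
     {f \<in> {1..n} \<rightarrow>\<^sub>E {1..m}. f 1 = b \<and> leq (\<eta> n) a (f n) \<and> (\<forall>i\<in>{1..<n}. leq (\<eta> i) (f (Suc i)) (f i))}"

lemma finite_path_maps: "finite (path_maps n \<eta> m a b)"
  by (rule finite_subset[of _ "{1..n} \<rightarrow>\<^sub>E {1..m}"]) (auto simp: path_maps_def intro: finite_PiE)

text \<open>
  A walk lists the values of a map at the positions after \<open>n\<close>, at \<open>n\<close>, and so on down to \<open>1\<close>. The
  induction splits the maps according to the value at their last position.
\<close>

lemma walks_eq_card_path_maps:
  assumes "n \<ge> 1" "b \<in> {1..m}"
  shows "walks m (word n \<eta>) a b = card (path_maps n \<eta> m a b)"
  using assms(1)
proof (induction n arbitrary: a rule: dec_induct)
  case base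
  have word: "word 1 \<eta> = [\<eta> 1]" by simp
  have "path_maps 1 \<eta> m a b = (if leq (\<eta> 1) a b then {\<lambda>x\<in>{1}. b} else {})"
    using assms(2) by (auto simp: path_maps_def PiE_iff extensional_def fun_eq_iff)
  moreover have "walks m (word 1 \<eta>) a b = (\<Sum>c = 1..m. if c = b then of_bool (leq (\<eta> 1) a b) else 0)"
    unfolding word walks.simps by (intro sum.cong) auto
  ultimately show ?case using assms(2) by simp
next
  case (step n)
  have word: "word (Suc n) \<eta> = \<eta> (Suc n) # word n \<eta>" by simp
  define C where "C = {c\<in>{1..m}. leq (\<eta> (Suc n)) a c}"
  have card: "card {f \<in> path_maps (Suc n) \<eta> m a b. f (Suc n) = c} = card (path_maps n \<eta> m c b)"
    if "c \<in> C" for c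
  proof (rule bij_betw_same_card[OF bij_betw_byWitness[where f' = "\<lambda>f. f(Suc n := c)"]])
    show "\<forall>f\<in>{f \<in> path_maps (Suc n) \<eta> m a b. f (Suc n) = c}. (f(Suc n := undefined))(Suc n := c) = f"
      by auto
    show "\<forall>f\<in>path_maps n \<eta> m c b. (f(Suc n := c))(Suc n := undefined) = f"
      by (auto simp: path_maps_def PiE_iff extensional_def fun_eq_iff)
    show "(\<lambda>f. f(Suc n := undefined)) ` {f \<in> path_maps (Suc n) \<eta> m a b. f (Suc n) = c} \<subseteq> path_maps n \<eta> m c b"
    proof safe
      fix f assume f: "f \<in> path_maps (Suc n) \<eta> m a b" "c = f (Suc n)"
      then have "leq (\<eta> n) (f (Suc n)) (f n)" using step.hyps by (auto simp: path_maps_def)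
      then show "f(Suc n := undefined) \<in> path_maps n \<eta> m (f (Suc n)) b"
        using f step.hyps by (auto simp: path_maps_def PiE_iff extensional_def)
    qed
    show "(\<lambda>f. f(Suc n := c)) ` path_maps n \<eta> m c b \<subseteq> {f \<in> path_maps (Suc n) \<eta> m a b. f (Suc n) = c}"
      using that step.hyps by (auto simp: path_maps_def PiE_iff extensional_def C_def less_Suc_eq)
  qed
  have "path_maps (Suc n) \<eta> m a b = (\<Union>c\<in>C. {f \<in> path_maps (Suc n) \<eta> m a b. f (Suc n) = c})"
    by (auto simp: path_maps_def C_def PiE_iff)
  then have "card (path_maps (Suc n) \<eta> m a b) =
      card (\<Union>c\<in>C. {f \<in> path_maps (Suc n) \<eta> m a b. f (Suc n) = c})"
    by (rule arg_cong)
  also have "\<dots> = (\<Sum>c\<in>C. card {f \<in> path_maps (Suc n) \<eta> m a b. f (Suc n) = c})"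
    by (rule card_UN_disjoint) (auto simp: C_def finite_path_maps)
  also have "\<dots> = (\<Sum>c\<in>C. walks m (word n \<eta>) c b)"
    by (intro sum.cong refl) (simp only: card step.IH)
  also have "\<dots> = (\<Sum>c = 1..m. of_bool (leq (\<eta> (Suc n)) a c) * walks m (word n \<eta>) c b)"
    unfolding C_def by (intro sum.mono_neutral_cong_left) auto
  also have "\<dots> = walks m (word (Suc n) \<eta>) a b"
    by (simp only: word walks.simps)
  finally show ?case by (rule sym)
qed

lemma card_order_preserving_maps:
  assumes "n \<ge> 1"
  shows "card (order_preserving_maps {1..n} (cyc_order n \<eta>) m) = closed_walks m (word n \<eta>)"
proof -
  have split: "(\<forall>i\<in>{1..n}. leq (\<eta> i) (f (cyc_succ n i)) (f i)) \<longleftrightarrow>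
      leq (\<eta> n) (f 1) (f n) \<and> (\<forall>i\<in>{1..<n}. leq (\<eta> i) (f (Suc i)) (f i))" for f
  proof -
    have "{1..n} = insert n {1..<n}" using assms by auto
    then show ?thesis by (simp add: cyc_succ_def)
  qed
  have "order_preserving_maps {1..n} (cyc_order n \<eta>) m = (\<Union>a\<in>{1..m}. path_maps n \<eta> m a a)"
    unfolding order_preserving_maps_def monotone_cyc_order_iff split path_maps_def
    using assms by (auto simp: PiE_iff)
  moreover have "card (\<Union>a\<in>{1..m}. path_maps n \<eta> m a a) = (\<Sum>a\<in>{1..m}. card (path_maps n \<eta> m a a))"
    by (rule card_UN_disjoint) (simp_all add: finite_path_maps, auto simp: path_maps_def)
  ultimately show ?thesis
    using walks_eq_card_path_maps[OF assms] by (simp add: closed_walks_def)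
qed

section \<open>Cyclic records of permutations\<close>

lemma count_records_eq_records:
  "count_records \<eta> \<pi> h is = records (map (\<lambda>i. (\<eta> i, \<pi> i)) is) h"
proof (induction "is" arbitrary: h)
  case (Cons i "is")
  then show ?case by (cases "\<eta> i") (auto simp: max_def min_def)
qed simp

lemma cyc_pred_funpow:
  assumes "r \<in> {1..n}" "k < n"
  shows "(cyc_pred n ^^ k) r = (if k < r then r - k else n + r - k)"
  using assms(2)
proof (induction k)
  case (Suc k)
  then show ?case using assms(1) by (auto simp: cyc_pred_def)
qed (use assms in auto)

lemma cyc_pred_orbit:
  assumes "r \<in> {1..n}"
  shows "map (\<lambda>k. (cyc_pred n ^^ k) r) [1..<n] = rev [1..<r] @ rev [Suc r..<Suc n]"
proof (rule nth_equalityI)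
  fix i assume "i < length (map (\<lambda>k. (cyc_pred n ^^ k) r) [1..<n])"
  then have i: "i < n - 1" by simp
  then have "map (\<lambda>k. (cyc_pred n ^^ k) r) [1..<n] ! i = (if Suc i < r then r - Suc i else n + r - Suc i)"
    by (simp add: cyc_pred_funpow[OF assms] del: funpow.simps)
  also have "\<dots> = (rev [1..<r] @ rev [Suc r..<Suc n]) ! i"
    using i assms by (auto simp: nth_append rev_nth simp del: upt_Suc)
  finally show "map (\<lambda>k. (cyc_pred n ^^ k) r) [1..<n] ! i = (rev [1..<r] @ rev [Suc r..<Suc n]) ! i" .
qed (use assms in auto)

lemma final_less:
  assumes "\<And>v. (Pos, v) \<in> set xs \<Longrightarrow> v < H" "h < H"
  shows "final xs h < H"
  using assms
proof (induction xs arbitrary: h)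
  case (Cons x xs)
  have "update x h < H"
    using Cons.prems by (cases x rule: item_cases) auto
  then show ?case using Cons by auto
qed simp

text \<open>
  A threshold that has dropped below \<open>H\<close> cannot return to \<open>H\<close> if no item with sign \<open>Pos\<close> reaches \<open>H\<close>.
\<close>

lemma final_le_and_records:
  assumes "\<And>v. (Pos, v) \<in> set xs \<Longrightarrow> v < H"
  shows "final xs H \<le> H" "final xs H = H \<Longrightarrow> records xs H = 0"
proof -
  have "final xs H < H \<or> final xs H = H \<and> records xs H = 0"
    using assms
  proof (induction xs)
    case (Cons x xs)
    have le: "update x H \<le> H"
      using Cons.prems by (cases x rule: item_cases) (force simp: less_imp_le)+
    show ?case
    proof (cases "update x H = H")
      case True
      then show ?thesis using Cons by auto
    next
      case False
      then have "final xs (update x H) < H" using le Cons.prems by (intro final_less) auto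
      then show ?thesis by simp
    qed
  qed simp
  then show "final xs H \<le> H" "final xs H = H \<Longrightarrow> records xs H = 0" by auto
qed

text \<open>
  Started at the largest value \<open>\<pi> r\<close> of sign \<open>Pos\<close>, the threshold never exceeds \<open>\<pi> r\<close>. So it is back at
  \<open>\<pi> r\<close> once \<open>r\<close> is inspected again, and the prescribed inspection is one period of the stationary one,
  read from another starting point.
\<close>

lemma crec_eq_cyclic_records:
  assumes "nonconstant n \<eta>" "\<pi> permutes {1..n}"
  shows "crec n \<eta> \<pi> = cyclic_records (zip (word n \<eta>) (map \<pi> (rev [1..<Suc n])))"
proof -
  define P where "P = pos_indices n \<eta>"
  define item where "item i = (\<eta> i, \<pi> i)" for i
  have item: "item = (\<lambda>i. (\<eta> i, \<pi> i))" by (rule ext) (rule item_def)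
  define r where "r = first_record n \<eta> \<pi>"
  have P: "finite P" "P \<noteq> {}" using assms(1) by (auto simp: P_def pos_indices_def nonconstant_def)
  have inj: "inj \<pi>" using assms(2) by (rule permutes_inj)
  have "Max (\<pi> ` P) \<in> \<pi> ` P" using P by (intro Max_in) auto
  then obtain q where q: "q \<in> P" "\<pi> q = Max (\<pi> ` P)" by (metis imageE)
  have rP: "r \<in> P \<and> \<pi> r = Max (\<pi> ` P)"
    unfolding r_def first_record_def P_def[symmetric]
  proof (rule theI[of _ q])
    show "q \<in> P \<and> \<pi> q = Max (\<pi> ` P)" using q by blast
    show "p = q" if "p \<in> P \<and> \<pi> p = Max (\<pi> ` P)" for p
      by (rule injD[OF inj]) (use that q in simp)
  qed
  then have r: "r \<in> {1..n}" "\<eta> r = Pos"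
    unfolding P_def pos_indices_def by blast+
  have max: "\<pi> i \<le> \<pi> r" if "i \<in> P" for i
    using rP that P(1) by (metis Max_ge finite_imageI imageI)
  define rest where "rest = rev [1..<r] @ rev [Suc r..<Suc n]"
  have less: "v < \<pi> r" if "(Pos, v) \<in> set (map item rest)" for v
  proof -
    from that obtain i where i: "i \<in> set rest" "item i = (Pos, v)"
      unfolding set_map by (metis imageE)
    have "i \<in> {1..n}" "i \<noteq> r" using i(1) r(1) by (auto simp: rest_def simp del: upt_Suc)
    moreover from i(2) have "\<eta> i = Pos" "v = \<pi> i" by (simp_all add: item_def)
    ultimately have "v \<le> \<pi> r" "v \<noteq> \<pi> r"
      using max[of i] inj_eq[OF inj] by (simp_all add: P_def pos_indices_def)
    then show ?thesis by simp
  qed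
  have "crec n \<eta> \<pi> = Suc (records (map item rest) (\<pi> r))"
    unfolding crec_def r_def[symmetric] Let_def cyc_pred_orbit[OF r(1)] count_records_eq_records rest_def
    by (simp only: item)
  also have "\<dots> = cyclic_records (item r # map item rest)"
  proof (rule cyclic_records_Cons[symmetric])
    have "final (map item rest) (\<pi> r) \<le> \<pi> r"
      by (rule final_le_and_records) (rule less)
    then show "update (item r) (final (map item rest) (\<pi> r)) = \<pi> r"
      by (simp add: item_def r(2))
    show "records (map item rest) (\<pi> r) = 0" if "final (map item rest) (\<pi> r) = \<pi> r"
      by (rule final_le_and_records(2)[OF _ that]) (rule less)
  qed
  also have "\<dots> = cyclic_records (map item (rev [Suc r..<Suc n]) @ map item (r # rev [1..<r]))"
    by (subst cyclic_records_rotate) (simp add: rest_def del: upt_Suc)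
  also have "map item (rev [Suc r..<Suc n]) @ map item (r # rev [1..<r]) = map item (rev [1..<Suc n])"
  proof -
    have "[1..<Suc n] = [1..<r] @ [r..<Suc n]"
      using upt_add_eq_append[of 1 r "Suc n - r"] r(1) by (simp del: upt_Suc)
    moreover have "[r..<Suc n] = r # [Suc r..<Suc n]"
      using r(1) by (intro upt_conv_Cons) auto
    ultimately have "[1..<Suc n] = [1..<r] @ r # [Suc r..<Suc n]" by (simp only:)
    then show ?thesis by (simp del: upt_Suc)
  qed
  also have "map item (rev [1..<Suc n]) = zip (word n \<eta>) (map \<pi> (rev [1..<Suc n]))"
    by (simp only: zip_map_map zip_same_conv_map map_map item comp_def prod.case)
  finally show ?thesis .
qed

text \<open>
  A permutation is determined by the list of its values, and each arrangement of \<open>{1..n}\<close> is such a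
  list.
\<close>

lemma sum_crec_eq_cyclic_sum:
  assumes "nonconstant n \<eta>"
  shows "(\<Sum>\<pi> | \<pi> permutes {1..n}. m ^ crec n \<eta> \<pi>) = cyclic_sum m (word n \<eta>) {1..n}"
proof -
  let ?list = "\<lambda>\<pi>. map \<pi> (rev [1..<Suc n])"
  have inj: "inj_on ?list {\<pi>. \<pi> permutes {1..n}}"
  proof (rule inj_onI)
    fix \<pi> \<sigma> assume perm: "\<pi> \<in> {\<pi>. \<pi> permutes {1..n}}" "\<sigma> \<in> {\<pi>. \<pi> permutes {1..n}}"
      and "?list \<pi> = ?list \<sigma>"
    then have "\<pi> i = \<sigma> i" if "i \<in> {1..n}" for i
      using that by (simp del: upt_Suc)
    then show "\<pi> = \<sigma>" using perm by (metis ext mem_Collect_eq permutes_not_in)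
  qed
  have "?list ` {\<pi>. \<pi> permutes {1..n}} \<subseteq> permutations_of_set {1..n}"
  proof safe
    fix \<pi> assume "\<pi> permutes {1..n}"
    moreover have "rev [1..<Suc n] \<in> permutations_of_set {1..n}"
      by (auto simp: permutations_of_set_def)
    ultimately show "?list \<pi> \<in> permutations_of_set {1..n}"
      using permutations_of_set_image_permutes by blast
  qed
  moreover have "card (?list ` {\<pi>. \<pi> permutes {1..n}}) = card (permutations_of_set {1..n})"
    using inj by (simp add: card_image card_permutations)
  ultimately have "?list ` {\<pi>. \<pi> permutes {1..n}} = permutations_of_set {1..n}"
    by (intro card_subset_eq) auto
  then have bij: "bij_betw ?list {\<pi>. \<pi> permutes {1..n}} (permutations_of_set {1..n})"
    using inj by (simp add: bij_betw_def)
  show ?thesis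
    unfolding cyclic_sum_def sum.reindex_bij_betw[OF bij, symmetric]
    by (intro sum.cong refl) (simp only: crec_eq_cyclic_records[OF assms] mem_Collect_eq)
qed

lemma sum_crec:
  assumes "nonconstant n \<eta>" "m \<ge> 1"
  shows "(\<Sum>\<pi> | \<pi> permutes {1..n}. m ^ crec n \<eta> \<pi>) =
         fact n * card (order_preserving_maps {1..n} (cyc_order n \<eta>) m)"
proof -
  have "n \<ge> 1" using assms(1) by (auto simp: nonconstant_def)
  then show ?thesis
    unfolding sum_crec_eq_cyclic_sum[OF assms(1)]
    using cyclic_sum_eq_closed_walks[of "{1..n}" "word n \<eta>" m] assms(2)
    by (simp only: card_order_preserving_maps) (simp del: upt_Suc)
qed

section \<open>The order polynomial\<close>

text \<open>
  Two polynomials that agree at all positive integers are equal.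
\<close>

lemma order_polynomial_eqI:
  assumes "\<And>m. m \<ge> 1 \<Longrightarrow> poly p (of_nat m) = of_nat (card (order_preserving_maps A r m))"
  shows "order_polynomial A r = p"
  unfolding order_polynomial_def
proof (rule the_equality)
  show "\<forall>m\<ge>1. poly p (of_nat m) = of_nat (card (order_preserving_maps A r m))"
    using assms by blast
next
  fix q :: "rat poly"
  assume q: "\<forall>m\<ge>1. poly q (of_nat m) = of_nat (card (order_preserving_maps A r m))"
  have "of_nat ` {1..} \<subseteq> {x. poly (q - p) x = 0}" using q assms by auto
  moreover have "infinite (of_nat ` {1::nat..} :: rat set)"
    by (simp add: finite_image_iff inj_on_def infinite_Ici)
  ultimately have "q - p = 0" using poly_roots_finite finite_subset by blast
  then show "q = p" by simp
qed

theorem theorem4p3: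
  fixes n :: nat and \<eta> :: "nat \<Rightarrow> sign"
  assumes "nonconstant n \<eta>"
  shows "(\<Sum>\<pi> | \<pi> permutes {1..n}. monom 1 (crec n \<eta> \<pi>))
           = smult (fact n) (order_polynomial {1..n} (cyc_order n \<eta>))"
proof -
  define Q :: "rat poly" where "Q = (\<Sum>\<pi> | \<pi> permutes {1..n}. monom 1 (crec n \<eta> \<pi>))"
  have "poly (smult (1 / fact n) Q) (of_nat m) =
      of_nat (card (order_preserving_maps {1..n} (cyc_order n \<eta>) m))" if "m \<ge> 1" for m
  proof -
    have "poly Q (of_nat m) = of_nat (\<Sum>\<pi> | \<pi> permutes {1..n}. m ^ crec n \<eta> \<pi>)"
      by (simp add: Q_def poly_sum poly_monom)
    also have "\<dots> = fact n * of_nat (card (order_preserving_maps {1..n} (cyc_order n \<eta>) m))"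
      unfolding sum_crec[OF assms that] by simp
    finally show ?thesis by simp
  qed
  then have "order_polynomial {1..n} (cyc_order n \<eta>) = smult (1 / fact n) Q"
    by (rule order_polynomial_eqI)
  then show ?thesis by (simp add: Q_def)
qed

end
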